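(* Let $u\in\mathbb{C}$ with $\Re u>0$ and let $v\in\mathbb{R}$ with $v>0$. Then the Laurent series $$\Psi(u,v,z)=\sum_{n\in\mathbb{Z}}\Gamma\Bigl(u+\frac{2ivn}{\pi}\Bigr)\,z^n$$ has the boundary $\partial\mathcal{C}_v=\{z\in\mathbb{C}:|z|=e^{-v}\}\cup\{z\in\mathbb{C}:|z|=e^{v}\}$ of the annulus $\mathcal{C}_v=\{z\in\mathbb{C}: e^{-v}<|z|<e^{v}\}$ as a natural boundary.
   Context: $\Gamma$ is the Euler Gamma function. By Stirling's formula, for $v\neq 0$ the Laurent series $\Psi(u,v,z)$ converges and defines an analytic function of $z$ in the annulus $\mathcal{C}_v=\{z\in\mathbb{C}: e^{-|v|}<|z|<e^{|v|}\}$. An analytic function $f$ on a domain $\Omega\subset\mathbb{C}$ has $\partial\Omega$ as a natural boundary if it cannot be continued analytically across any boundary point: for every $z_0\in\partial\Omega$ there is no open disc $D$ centred at $z_0$ and no holomorphic function $g$ on $D$ with $g=f$ on $D\cap\Omega$. *)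

theory Defs
  imports "HOL-Complex_Analysis.Complex_Analysis"
begin

text \<open>The bilateral series is an unordered sum over all integers, which for a Laurent series is
  the appropriate (absolute) convergence inside its annulus.\<close>

definition Psi :: "complex \<Rightarrow> real \<Rightarrow> complex \<Rightarrow> complex" where
  "Psi u v z = (\<Sum>\<^sub>\<infinity>n::int. Gamma (u + 2 * \<i> * of_real v * of_int n / of_real pi) * z powi n)"

definition has_natural_boundary :: "(complex \<Rightarrow> complex) \<Rightarrow> complex set \<Rightarrow> bool" where
  "has_natural_boundary f \<Omega> \<longleftrightarrow>
     open \<Omega> \<and> connected \<Omega> \<and> f holomorphic_on \<Omega> \<and>
     (\<forall>z0 \<in> frontier \<Omega>. \<not> (\<exists>r>0. \<exists>g. g holomorphic_on ball z0 r \<and>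
        (\<forall>z \<in> ball z0 r \<inter> \<Omega>. g z = f z)))"

end

theory Submission
  imports Defs
begin

text \<open>Put \<open>L = \<pi>\<^sup>2 / v\<close>, \<open>q = e\<^sup>L > 1\<close> and
\<open>S(s) = \<Sum>\<^sub>k q\<^sup>k\<^sup>u exp (- q\<^sup>k s)\<close>, summed over all integers \<open>k\<close>, for \<open>Re s > 0\<close>. Since
\<open>S(q s) = q\<^sup>-\<^sup>u S(s)\<close>, the function \<open>y \<mapsto> e\<^sup>u\<^sup>y S(e\<^sup>y)\<close> has period \<open>L\<close> on the strip
\<open>\<bar>Im y\<bar> < \<pi> / 2\<close>. The substitution \<open>y = (i L / 2 \<pi>) Ln z\<close> wraps this strip around the annulus
\<open>e\<^sup>-\<^sup>v < \<bar>z\<bar> < e\<^sup>v\<close>, so the periodic function becomes a single-valued holomorphic function of \<open>z\<close>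
there. Its Laurent coefficients are Fourier coefficients of a sum of translates; unfolding the
period gives an integral over the whole line, which is Euler's integral for
\<open>\<Gamma>(u + 2 i v n / \<pi>)\<close> up to the factor \<open>L\<close> (lemma \<open>annulus_fun_coeff\<close>). So the
Laurent expansion of a holomorphic function (lemma \<open>Laurent_series_annulus\<close>) identifies
\<open>\<Psi>(u, v, z)\<close> with \<open>L\<close> times this function, and the absolute convergence of the series comes with it,
with no appeal to Stirling's formula. The identity is the Poisson summation formula for
\<open>exp (u x - e\<^sup>x)\<close>.

The two boundary circles correspond to the two halves of the imaginary axis in the variable
\<open>s = e\<^sup>y\<close>, and continuation across a boundary point would make \<open>S\<close> bounded near some \<open>i y\<^sub>0\<close>.
This is impossible (lemma \<open>lac_sum_unbounded_at_imaginary\<close>). On the line \<open>s = 1 + i t\<close> the sum is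
almost periodic with frequencies \<open>q\<^sup>k\<close>, and its coefficient at frequency \<open>1\<close> is \<open>1 / e\<close>. As the
other frequencies keep a fixed distance from \<open>1\<close>, integrating \<open>S(1 + i t) e\<^sup>i\<^sup>t\<close> over an interval of
length \<open>T\<close> gives \<open>T / e + O(1)\<close>, uniformly in the position of the interval (lemma
\<open>mean_value_lac_sum\<close>). But scaling by \<open>q\<^sup>N\<close> turns boundedness near \<open>i y\<^sub>0\<close> into a bound
\<open>O(q\<^sup>-\<^sup>N\<^sup>R\<^sup>e\<^sup>u)\<close> for \<open>S(1 + i t)\<close> on an interval of length proportional to \<open>q\<^sup>N\<close>; since
\<open>Re u > 0\<close>, the two estimates contradict each other for large \<open>N\<close>.\<close>

section \<open>Laurent series on an annulus\<close>

lemma has_sum_powi_nonneg: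
  fixes x :: "'a :: {real_normed_field, banach}"
  assumes "norm x < 1"
  shows "((\<lambda>n. x powi n) has_sum 1 / (1 - x)) {0::int..}"
proof -
  have "((\<lambda>n. x ^ n) has_sum 1 / (1 - x)) (UNIV :: nat set)"
    by (rule norm_summable_imp_has_sum)
       (use assms in \<open>auto simp: norm_power intro!: geometric_sums summable_geometric\<close>)
  also have "?this \<longleftrightarrow> ?thesis"
    by (rule has_sum_reindex_bij_witness[of _ nat int]) auto
  finally show ?thesis .
qed

lemma has_sum_powi_neg:
  fixes x :: "'a :: {real_normed_field, banach}"
  assumes "norm x > 1"
  shows "((\<lambda>n. x powi n) has_sum 1 / (x - 1)) {..<0::int}"
proof -
  have x0: "x \<noteq> 0" using assms by auto
  have "norm (inverse x) < 1"
    using assms by (simp add: norm_inverse inverse_less_1_iff)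
  then have "((\<lambda>n. inverse x * inverse x ^ n) has_sum inverse x * (1 / (1 - inverse x))) (UNIV :: nat set)"
    by (intro has_sum_cmult_right norm_summable_imp_has_sum)
       (auto simp: norm_power intro!: geometric_sums summable_geometric)
  also have "?this \<longleftrightarrow> ((\<lambda>n. x powi n) has_sum 1 / (x - 1)) {..<0::int}"
  proof (rule has_sum_reindex_bij_witness[of _ "\<lambda>n. nat (-n - 1)" "\<lambda>n. - int n - 1"])
    fix n :: nat
    show "x powi (- int n - 1) = inverse x * inverse x ^ n"
      using x0 by (simp add: power_int_def nat_add_distrib power_inverse)
  next
    show "inverse x * (1 / (1 - inverse x)) = 1 / (x - 1)"
      using x0 assms by (auto simp: field_simps)
  qed auto
  finally show ?thesis .
qed

text \<open>An unordered sum dominated by a summable family of constants converges uniformly, so it may be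
integrated term by term. Both passages from a series to its integrals rest on this: the Cauchy kernels
of the Laurent expansion and the sums over \<open>q\<^sup>k\<close> below.\<close>

lemma integral_has_sum:
  fixes f :: "'i \<Rightarrow> real \<Rightarrow> complex"
  assumes "\<And>n. n \<in> X \<Longrightarrow> continuous_on {a..b} (f n)"
    and "\<And>n t. n \<in> X \<Longrightarrow> t \<in> {a..b} \<Longrightarrow> norm (f n t) \<le> M n"
    and "M summable_on X"
    and "\<And>t. t \<in> {a..b} \<Longrightarrow> ((\<lambda>n. f n t) has_sum g t) X"
  shows "((\<lambda>n. integral {a..b} (f n)) has_sum integral {a..b} g) X"
proof -
  have ul: "uniform_limit {a..b} (\<lambda>N t. \<Sum>n\<in>N. f n t) g (finite_subsets_at_top X)"
    by (rule Weierstrass_m_test_general'[OF assms(2,4,3)])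
  \<comment> \<open>extended by zero beyond the subsets of \<open>X\<close>, so that every member of the net is continuous\<close>
  define F where "F = (\<lambda>N t. if N \<subseteq> X then \<Sum>n\<in>N. f n t else 0)"
  have ev: "\<forall>\<^sub>F N in finite_subsets_at_top X. finite N \<and> N \<subseteq> X"
    by (rule eventually_finite_subsets_at_top_weakI) auto
  have ul': "uniform_limit {a..b} F g (finite_subsets_at_top X)"
    using ul
    by (rule uniform_limit_cong[THEN iffD1, rotated -1])
       (use ev in \<open>auto simp: F_def elim: eventually_mono\<close>)
  have cont: "continuous_on {a..b} (F N)" for N
    using assms(1) by (cases "N \<subseteq> X") (auto simp: F_def intro!: continuous_on_sum)
  obtain I J where IJ: "\<And>N. (F N has_integral I N) {a..b}" "(g has_integral J) {a..b}"
    "(I \<longlongrightarrow> J) (finite_subsets_at_top X)"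
    using uniform_limit_integral[OF ul' cont] by auto
  have "(I \<longlongrightarrow> J) (finite_subsets_at_top X) \<longleftrightarrow>
        ((\<lambda>N. \<Sum>n\<in>N. integral {a..b} (f n)) \<longlongrightarrow> J) (finite_subsets_at_top X)"
  proof (rule tendsto_cong)
    show "\<forall>\<^sub>F N in finite_subsets_at_top X. I N = (\<Sum>n\<in>N. integral {a..b} (f n))"
      using ev
    proof eventually_elim
      case (elim N)
      have "I N = integral {a..b} (F N)" by (rule integral_unique[OF IJ(1), symmetric])
      also have "\<dots> = integral {a..b} (\<lambda>t. \<Sum>n\<in>N. f n t)" using elim by (simp add: F_def)
      also have "\<dots> = (\<Sum>n\<in>N. integral {a..b} (f n))"
        by (rule integral_sum) (use elim assms(1) in \<open>auto intro!: integrable_continuous_real\<close>)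
      finally show ?case .
    qed
  qed
  then show "((\<lambda>n. integral {a..b} (f n)) has_sum integral {a..b} g) X"
    using IJ(2,3) by (simp add: has_sum_def integral_unique)
qed

definition circle_point :: "real \<Rightarrow> real \<Rightarrow> complex" where
  "circle_point \<rho> t = of_real \<rho> * exp (2 * of_real pi * \<i> * of_real t)"

text \<open>The mean of \<open>h\<close> over a circle is \<open>1 / (2 \<pi> i)\<close> times the contour integral of \<open>h w / w\<close>. In this
normalisation Laurent coefficients are means of \<open>f w * w powi (- n)\<close>, that is, Fourier coefficients.\<close>

definition circle_mean :: "real \<Rightarrow> (complex \<Rightarrow> complex) \<Rightarrow> complex" where
  "circle_mean \<rho> h = integral {0..1} (\<lambda>t. h (circle_point \<rho> t))"

lemma circlepath_conv: "circlepath 0 \<rho> t = circle_point \<rho> t"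
  by (simp add: circlepath circle_point_def)

lemma norm_circle_point [simp]: "norm (circle_point \<rho> t) = \<bar>\<rho>\<bar>"
  by (simp add: circle_point_def norm_mult)

lemma continuous_circle_point [continuous_intros]: "continuous_on S (circle_point \<rho>)"
  unfolding circle_point_def by (intro continuous_intros)

lemma contour_integral_circle_mean:
  assumes "\<rho> > 0"
  shows "contour_integral (circlepath 0 \<rho>) (\<lambda>w. h w / w) = 2 * of_real pi * \<i> * circle_mean \<rho> h"
proof -
  have "contour_integral (circlepath 0 \<rho>) (\<lambda>w. h w / w) =
        integral {0..1} (\<lambda>t. 2 * of_real pi * \<i> * h (circle_point \<rho> t))"
    unfolding contour_integral_integral
    by (rule integral_cong) (use assms in \<open>simp add: circlepath_conv vector_derivative_circlepath circle_point_def field_simps\<close>)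
  then show ?thesis by (simp add: circle_mean_def)
qed

lemma open_annulus: "open {z :: complex. a < norm z \<and> norm z < b}"
  by (intro open_Collect_conj open_Collect_less continuous_intros)

lemma homotopic_loops_circles_annulus:
  assumes "a < r" "r < b" "a < s" "s < b" "0 < r" "0 < s"
  shows "homotopic_loops {z. a < norm z \<and> norm z < b} (circlepath 0 r) (circlepath 0 s)"
proof (rule homotopic_loops_linear)
  fix t :: real
  show "closed_segment (circlepath 0 r t) (circlepath 0 s t) \<subseteq> {z. a < norm z \<and> norm z < b}"
  proof
    fix w assume "w \<in> closed_segment (circlepath 0 r t) (circlepath 0 s t)"
    then obtain x where x: "0 \<le> x" "x \<le> 1"
      and w: "w = (1 - x) *\<^sub>R circlepath 0 r t + x *\<^sub>R circlepath 0 s t"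
      by (auto simp: closed_segment_def)
    have "w = circle_point ((1 - x) * r + x * s) t"
      by (simp add: w circlepath_conv circle_point_def scaleR_conv_of_real algebra_simps)
    moreover have "(1 - x) * r + x * s \<ge> min r s" "(1 - x) * r + x * s \<le> max r s"
      using convex_bound_le[of "-r" "- min r s" "-s" "1-x" x] convex_bound_le[of r "max r s" s "1-x" x] x by auto
    ultimately show "w \<in> {z. a < norm z \<and> norm z < b}"
      using assms by auto
  qed
qed auto

text \<open>Concentric circles are homotopic in the annulus, and \<open>h w / w\<close> is holomorphic there because the annulus
omits the origin.\<close>

lemma circle_mean_eq:
  assumes f: "f holomorphic_on {z. a < norm z \<and> norm z < b}" and "0 \<le> a"
    and "a < r" "r < b" "a < s" "s < b"
  shows "circle_mean r f = circle_mean s f"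
proof -
  have pos: "0 < r" "0 < s" using assms by auto
  have "contour_integral (circlepath 0 r) (\<lambda>w. f w / w) = contour_integral (circlepath 0 s) (\<lambda>w. f w / w)"
    by (rule Cauchy_theorem_homotopic_loops[OF homotopic_loops_circles_annulus open_annulus])
       (use assms pos in \<open>auto intro!: holomorphic_intros\<close>)
  then show ?thesis
    using pos by (simp add: contour_integral_circle_mean)
qed

lemma circle_mean_cauchy_kernel:
  assumes "r > 0"
  shows "norm z < r \<Longrightarrow> circle_mean r (\<lambda>w. w / (w - z)) = 1"
    and "r < norm z \<Longrightarrow> circle_mean r (\<lambda>w. w / (w - z)) = 0"
proof -
  have eq: "contour_integral (circlepath 0 r) (\<lambda>w. 1 / (w - z)) =
             2 * of_real pi * \<i> * circle_mean r (\<lambda>w. w / (w - z))"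
    unfolding contour_integral_circle_mean[OF assms, symmetric]
    by (rule contour_integral_cong) (use assms in auto)
  {
    assume "norm z < r"
    then have "((\<lambda>w. 1 / (w - z)) has_contour_integral (2 * of_real pi * \<i> * 1)) (circlepath 0 r)"
      by (intro Cauchy_integral_circlepath_simple) auto
    then show "circle_mean r (\<lambda>w. w / (w - z)) = 1"
      using eq by (simp add: contour_integral_unique)
  next
    assume *: "r < norm z"
    have "((\<lambda>w. 1 / (w - z)) has_contour_integral 0) (circlepath 0 r)"
      by (rule Cauchy_theorem_disc_simple[of _ 0 "norm z"])
         (use * assms in \<open>auto intro!: holomorphic_intros\<close>)
    then show "circle_mean r (\<lambda>w. w / (w - z)) = 0"
      using eq by (simp add: contour_integral_unique)
  }
qed

text \<open>The difference quotient of \<open>f\<close> at \<open>z\<close>, multiplied by \<open>w\<close>, extends holomorphically across \<open>w = z\<close>, so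
its means over the inner and the outer circle agree. Splitting off \<open>f z\<close>, whose kernel has mean \<open>1\<close> on
the outer circle and \<open>0\<close> on the inner one, leaves the formula.\<close>

lemma Cauchy_annulus:
  assumes f: "f holomorphic_on {z. a < norm z \<and> norm z < b}" and "0 \<le> a"
    and "a < r" "r < norm z" "norm z < s" "s < b"
  shows "f z = circle_mean s (\<lambda>w. f w * (w / (w - z))) - circle_mean r (\<lambda>w. f w * (w / (w - z)))"
proof -
  define A where "A = {z :: complex. a < norm z \<and> norm z < b}"
  define k where "k = (\<lambda>w. if w = z then deriv f z else (f w - f z) / (w - z))"
  have "k holomorphic_on A"
    unfolding k_def A_def by (rule pole_lemma_open[OF f open_annulus])
  then have "(\<lambda>w. k w * w) holomorphic_on A" by (intro holomorphic_intros)
  then have eq: "circle_mean r (\<lambda>w. k w * w) = circle_mean s (\<lambda>w. k w * w)"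
    unfolding A_def by (rule circle_mean_eq) (use assms in auto)
  have cont: "continuous_on {0..1} (\<lambda>t. f (circle_point \<rho> t))" if "a < \<rho>" "\<rho> < b" for \<rho>
    by (rule continuous_on_compose2[OF holomorphic_on_imp_continuous_on[OF f] continuous_circle_point])
       (use that \<open>0 \<le> a\<close> in auto)
  have split: "circle_mean \<rho> (\<lambda>w. k w * w) =
     circle_mean \<rho> (\<lambda>w. f w * (w / (w - z))) - f z * circle_mean \<rho> (\<lambda>w. w / (w - z))"
    if "a < \<rho>" "\<rho> < b" "\<rho> \<noteq> norm z" for \<rho>
  proof -
    have ne: "circle_point \<rho> t \<noteq> z" for t
      using that \<open>0 \<le> a\<close> norm_circle_point[of \<rho> t] by auto
    have "circle_mean \<rho> (\<lambda>w. k w * w) = integral {0..1} (\<lambda>t. f (circle_point \<rho> t) * (circle_point \<rho> t / (circle_point \<rho> t - z))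
        - f z * (circle_point \<rho> t / (circle_point \<rho> t - z)))"
      unfolding circle_mean_def by (rule integral_cong) (use ne in \<open>simp add: k_def diff_divide_distrib algebra_simps\<close>)
    also have "\<dots> = circle_mean \<rho> (\<lambda>w. f w * (w / (w - z))) -
         integral {0..1} (\<lambda>t. f z * (circle_point \<rho> t / (circle_point \<rho> t - z)))"
      unfolding circle_mean_def
      by (rule integral_diff; rule integrable_continuous_real)
         (use ne in \<open>auto intro!: continuous_intros cont that\<close>)
    also have "integral {0..1} (\<lambda>t. f z * (circle_point \<rho> t / (circle_point \<rho> t - z))) =
        f z * circle_mean \<rho> (\<lambda>w. w / (w - z))"
      unfolding circle_mean_def by (rule integral_mult_right)
    finally show ?thesis .
  qed
  have "0 < r" "0 < s" using assms by auto
  then show ?thesis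
    using eq split[of r] split[of s] assms circle_mean_cauchy_kernel[of r z] circle_mean_cauchy_kernel[of s z]
    by (simp add: algebra_simps)
qed

text \<open>In Cauchy's formula the kernel \<open>w / (w - z)\<close> is a geometric series in \<open>z / w\<close>: on the outer circle it
gives the terms with \<open>n \<ge> 0\<close>, on the inner circle those with \<open>n < 0\<close>. The domination by geometric
series makes the resulting sum unordered.\<close>

theorem Laurent_series_annulus:
  assumes f: "f holomorphic_on {z. a < norm z \<and> norm z < b}" and "0 \<le> a"
    and "a < \<rho>" "\<rho> < b" and z: "a < norm z" "norm z < b"
  shows "((\<lambda>n::int. circle_mean \<rho> (\<lambda>w. f w * w powi (-n)) * z powi n) has_sum f z) UNIV"
proof -
  define c where "c = (\<lambda>n. circle_mean \<rho> (\<lambda>w. f w * w powi (-n)))"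
  have c: "circle_mean r (\<lambda>w. f w * w powi (-n)) = c n" if "a < r" "r < b" for r n
    unfolding c_def
    by (rule circle_mean_eq[of _ a b]) (use that assms in \<open>auto intro!: holomorphic_intros\<close>)
  obtain r where r: "a < r" "r < norm z" using dense[OF z(1)] by auto
  obtain s where s: "norm z < s" "s < b" using dense[OF z(2)] by auto
  have pos: "0 < r" "0 < s" "0 < norm z" using r s \<open>0 \<le> a\<close> by auto
  have cont: "continuous_on {0..1} (\<lambda>t. f (circle_point q t))" if "a < q" "q < b" for q
    by (rule continuous_on_compose2[OF holomorphic_on_imp_continuous_on[OF f] continuous_circle_point])
       (use that \<open>0 \<le> a\<close> in auto)
  have expand: "((\<lambda>n. c n * z powi n) has_sum circle_mean q (\<lambda>w. f w * g w)) X"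
    if q: "a < q" "q < b" and M: "(\<lambda>n. (norm z / q) powi n) summable_on X"
      and g: "\<And>w. norm w = q \<Longrightarrow> ((\<lambda>n. (z / w) powi n) has_sum g w) X" for q g X
  proof -
    have q0: "q > 0" using q \<open>0 \<le> a\<close> by auto
    obtain B where B: "\<And>t. t \<in> {0..1} \<Longrightarrow> norm (f (circle_point q t)) \<le> B"
      using compact_imp_bounded[OF compact_continuous_image[OF cont[OF q]]]
      unfolding bounded_iff by blast
    have nz: "circle_point q t \<noteq> 0" for t using q0 by (simp add: circle_point_def)
    have sum: "((\<lambda>n. integral {0..1} (\<lambda>t. f (circle_point q t) * (z / circle_point q t) powi n)) has_sum
             integral {0..1} (\<lambda>t. f (circle_point q t) * g (circle_point q t))) X"
    proof (rule integral_has_sum)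
      show "continuous_on {0..1} (\<lambda>t. f (circle_point q t) * (z / circle_point q t) powi n)" for n
        using nz pos by (intro continuous_intros cont q) auto
      show "norm (f (circle_point q t) * (z / circle_point q t) powi n) \<le> B * (norm z / q) powi n"
        if "t \<in> {0..1}" for n t
        using q0 B[OF that] by (auto simp: norm_mult norm_power_int norm_divide intro!: mult_right_mono)
      show "(\<lambda>n. B * (norm z / q) powi n) summable_on X"
        by (rule summable_on_cmult_right[OF M])
      show "((\<lambda>n. f (circle_point q t) * (z / circle_point q t) powi n) has_sum
               f (circle_point q t) * g (circle_point q t)) X" for t
        using q0 by (intro has_sum_cmult_right g) auto
    qed
    have coeff: "integral {0..1} (\<lambda>t. f (circle_point q t) * (z / circle_point q t) powi n) = c n * z powi n" for n
    proof -
      have "integral {0..1} (\<lambda>t. f (circle_point q t) * (z / circle_point q t) powi n) =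
            integral {0..1} (\<lambda>t. (f (circle_point q t) * circle_point q t powi (-n)) * z powi n)"
        by (simp add: power_int_divide_distrib power_int_minus field_simps)
      also have "\<dots> = circle_mean q (\<lambda>w. f w * w powi (-n)) * z powi n"
        by (simp add: circle_mean_def)
      finally show ?thesis using c[OF q] by simp
    qed
    show ?thesis using sum unfolding coeff by (simp add: circle_mean_def)
  qed
  have "((\<lambda>n. c n * z powi n) has_sum circle_mean s (\<lambda>w. f w * (w / (w - z)))) {0..}"
  proof (rule expand)
    show "(\<lambda>n. (norm z / s) powi n) summable_on {0..}"
      using has_sum_powi_nonneg[of "norm z / s"] s pos by (auto simp: summable_on_def)
    show "((\<lambda>n. (z / w) powi n) has_sum w / (w - z)) {0..}" if "norm w = s" for w
    proof -
      have "norm (z / w) < 1" unfolding norm_divide that using s pos by (metis divide_less_eq_1_pos)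
      moreover have "w \<noteq> 0" "w \<noteq> z" using that s pos by auto
      ultimately have "((\<lambda>n. (z / w) powi n) has_sum 1 / (1 - z / w)) {0..}"
        by (intro has_sum_powi_nonneg)
      also have "1 / (1 - z / w) = w / (w - z)" using \<open>w \<noteq> 0\<close> \<open>w \<noteq> z\<close> by (simp add: field_simps)
      finally show ?thesis .
    qed
  qed (use s z in auto)
  moreover have "((\<lambda>n. c n * z powi n) has_sum circle_mean r (\<lambda>w. f w * - (w / (w - z)))) {..<0}"
  proof (rule expand)
    show "(\<lambda>n. (norm z / r) powi n) summable_on {..<0}"
      using has_sum_powi_neg[of "norm z / r"] r pos by (auto simp: summable_on_def)
    show "((\<lambda>n. (z / w) powi n) has_sum - (w / (w - z))) {..<0}" if "norm w = r" for w
    proof -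
      have "norm (z / w) > 1" unfolding norm_divide that using r pos by (metis less_divide_eq_1_pos)
      moreover have "w \<noteq> 0" "w \<noteq> z" using that r pos by auto
      ultimately have "((\<lambda>n. (z / w) powi n) has_sum 1 / (z / w - 1)) {..<0}"
        by (intro has_sum_powi_neg)
      also have "1 / (z / w - 1) = w / (z - w)" using \<open>w \<noteq> 0\<close> by (simp add: field_simps)
      also have "\<dots> = - (w / (w - z))" by (metis minus_diff_eq minus_divide_right)
      finally show ?thesis .
    qed
  qed (use r z in auto)
  moreover have "circle_mean r (\<lambda>w. f w * - (w / (w - z))) = - circle_mean r (\<lambda>w. f w * (w / (w - z)))"
    by (simp add: circle_mean_def)
  moreover have "{0..} \<union> {..<0} = (UNIV :: int set)" by auto
  moreover have "{0..} \<inter> {..<0} = ({} :: int set)" by auto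
  ultimately have "((\<lambda>n. c n * z powi n) has_sum circle_mean s (\<lambda>w. f w * (w / (w - z)))
      + - circle_mean r (\<lambda>w. f w * (w / (w - z)))) UNIV"
    by (metis has_sum_Un_disjoint)
  then show ?thesis
    unfolding Cauchy_annulus[OF f \<open>0 \<le> a\<close> r s] c_def by simp
qed

section \<open>A lacunary exponential sum and its growth at the imaginary axis\<close>

text \<open>The term \<open>q\<^sup>k\<^sup>u exp (- q\<^sup>k s)\<close> with \<open>q = e\<^sup>L\<close>; complex powers of \<open>q\<close> are written with \<open>exp\<close> to stay
away from branches of the logarithm.\<close>

definition lac_term :: "complex \<Rightarrow> real \<Rightarrow> int \<Rightarrow> complex \<Rightarrow> complex" where
  "lac_term u L k s = exp (u * of_real (of_int k * L) - of_real (exp (of_int k * L)) * s)"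

definition lac_sum :: "complex \<Rightarrow> real \<Rightarrow> complex \<Rightarrow> complex" where
  "lac_sum u L s = (\<Sum>\<^sub>\<infinity>k. lac_term u L k s)"

text \<open>A majorant for all \<open>s\<close> with \<open>Re s \<ge> e\<close>, where \<open>a = Re u\<close>. Towards \<open>k = - \<infinity>\<close> the factor
\<open>q\<^sup>k\<^sup>u\<close> decays geometrically; towards \<open>k = \<infinity>\<close> the double exponential beats every power of \<open>q\<^sup>k\<close>, and
a geometric bound is enough.\<close>

definition lac_bound :: "real \<Rightarrow> real \<Rightarrow> real \<Rightarrow> int \<Rightarrow> real" where
  "lac_bound a L e k = (if k \<ge> 0 then exp ((a + 1)\<^sup>2 / (2 * e)) * exp (- L) powi k else exp (a * L) powi k)"

text \<open>After \<open>exp x \<ge> x\<^sup>2 / 2\<close> the claim is that a downward parabola lies below its vertex.\<close>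

lemma linear_minus_exp_le:
  fixes a e x :: real
  assumes "e > 0" "x \<ge> 0"
  shows "a * x - e * exp x \<le> (a + 1)\<^sup>2 / (2 * e) - x"
proof -
  have "e * exp x \<ge> e * (x\<^sup>2 / 2)"
    using exp_lower_Taylor_quadratic[OF assms(2)] assms by (intro mult_left_mono) auto
  moreover have "(a + 1)\<^sup>2 / (2 * e) - ((a + 1) * x - e * (x\<^sup>2 / 2)) = (e * x - (a + 1))\<^sup>2 / (2 * e)"
    using assms by (simp add: field_simps power2_eq_square)
  moreover have "(e * x - (a + 1))\<^sup>2 / (2 * e) \<ge> 0" using assms by simp
  ultimately show ?thesis by (simp add: algebra_simps)
qed

lemma norm_lac_term_le:
  assumes "L > 0" "0 < e" "e \<le> Re s"
  shows "norm (lac_term u L k s) \<le> lac_bound (Re u) L e k"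
proof -
  let ?x = "of_int k * L"
  have n: "norm (lac_term u L k s) = exp (Re u * ?x - exp ?x * Re s)"
    by (simp add: lac_term_def)
  show ?thesis
  proof (cases "k \<ge> 0")
    case True
    have "Re u * ?x - exp ?x * Re s \<le> Re u * ?x - e * exp ?x"
      using assms by (simp add: mult.commute)
    also have "\<dots> \<le> (Re u + 1)\<^sup>2 / (2 * e) - ?x"
      using assms True by (intro linear_minus_exp_le) auto
    finally have "norm (lac_term u L k s) \<le> exp ((Re u + 1)\<^sup>2 / (2 * e) - ?x)"
      unfolding n by simp
    also have "\<dots> = lac_bound (Re u) L e k"
      using True by (simp add: lac_bound_def exp_power_int mult_exp_exp)
    finally show ?thesis .
  next
    case False
    have "norm (lac_term u L k s) \<le> exp (Re u * ?x)"
      unfolding n using assms by simp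
    also have "\<dots> = lac_bound (Re u) L e k"
      using False by (simp add: lac_bound_def exp_power_int mult_ac)
    finally show ?thesis .
  qed
qed

lemma summable_lac_bound:
  assumes "a > 0" "L > 0"
  shows "lac_bound a L e summable_on UNIV"
proof -
  have "(\<lambda>k. exp ((a + 1)\<^sup>2 / (2 * e)) * exp (- L) powi k) summable_on {0::int..}"
    using has_sum_powi_nonneg[of "exp (- L)"] assms
    by (intro summable_on_cmult_right) (auto simp: summable_on_def)
  then have "lac_bound a L e summable_on {0..}"
    by (rule summable_on_cong[THEN iffD1, rotated]) (auto simp: lac_bound_def)
  moreover have "(\<lambda>k. exp (a * L) powi k) summable_on {..<0::int}"
    using has_sum_powi_neg[of "exp (a * L)"] assms by (auto simp: summable_on_def)
  then have "lac_bound a L e summable_on {..<0}"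
    by (rule summable_on_cong[THEN iffD1, rotated]) (auto simp: lac_bound_def)
  ultimately have "lac_bound a L e summable_on {0..} \<union> {..<0}"
    by (rule summable_on_Un_disjoint) auto
  moreover have "{0..} \<union> {..<0} = (UNIV :: int set)" by auto
  ultimately show ?thesis by simp
qed

lemma lac_sum_has_sum:
  assumes "Re u > 0" "L > 0" "Re s > 0"
  shows "((\<lambda>k. lac_term u L k s) has_sum lac_sum u L s) UNIV"
proof -
  have "(\<lambda>k. norm (lac_term u L k s)) summable_on UNIV"
    using Infinite_Sum.abs_summable_on_comparison_test'[OF summable_lac_bound[OF assms(1,2)] norm_lac_term_le[OF assms(2,3) order_refl]]
    by auto
  then have "(\<lambda>k. lac_term u L k s) summable_on UNIV" by (rule abs_summable_summable)
  then show ?thesis unfolding lac_sum_def by (rule has_sum_infsum)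
qed

lemma lac_sum_holomorphic:
  assumes "Re u > 0" "L > 0"
  shows "lac_sum u L holomorphic_on {s. Re s > 0}"
proof (rule analytic_imp_holomorphic, unfold analytic_on_def, intro ballI)
  fix s0 :: complex assume s0: "s0 \<in> {s. Re s > 0}"
  define r where "r = Re s0 / 2"
  have r: "r > 0" using s0 by (simp add: r_def)
  have Re: "Re s \<ge> r" if "s \<in> cball s0 r" for s
  proof -
    have "Re (s0 - s) \<le> r" using that complex_Re_le_cmod[of "s0 - s"] by (auto simp: dist_norm)
    then show ?thesis unfolding minus_complex.sel r_def by linarith
  qed
  have "uniform_limit (cball s0 r) (\<lambda>K s. \<Sum>k\<in>K. lac_term u L k s) (lac_sum u L) (finite_subsets_at_top UNIV)"
  proof (rule Weierstrass_m_test_general'[OF _ _ summable_lac_bound[OF assms]])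
    fix k s assume "s \<in> cball s0 r"
    then show "norm (lac_term u L k s) \<le> lac_bound (Re u) L r k"
      using r Re assms by (intro norm_lac_term_le) auto
  next
    fix s assume "s \<in> cball s0 r"
    then show "((\<lambda>k. lac_term u L k s) has_sum lac_sum u L s) UNIV"
      using r Re[of s] assms by (intro lac_sum_has_sum) auto
  qed
  then have "lac_sum u L holomorphic_on ball s0 r"
    by (rule holomorphic_uniform_limit[rotated])
       (auto simp: lac_term_def intro!: always_eventually continuous_intros holomorphic_intros)
  then show "\<exists>e>0. lac_sum u L holomorphic_on ball s0 e" using r by blast
qed

lemma lac_term_scale: "lac_term u L k (exp (of_real (of_int j * L)) * s) =
    exp (- u * of_real (of_int j * L)) * lac_term u L (k + j) s"
  unfolding lac_term_def exp_add[symmetric]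
  by (simp add: exp_of_real[symmetric] exp_add algebra_simps exp_diff)

lemma lac_sum_scale:
  "lac_sum u L (exp (of_real (of_int j * L)) * s) = exp (- u * of_real (of_int j * L)) * lac_sum u L s"
proof -
  have "lac_sum u L (exp (of_real (of_int j * L)) * s) =
     exp (- u * of_real (of_int j * L)) * (\<Sum>\<^sub>\<infinity>k. lac_term u L (k + j) s)"
    unfolding lac_sum_def lac_term_scale by (rule infsum_cmult_right')
  also have "(\<Sum>\<^sub>\<infinity>k. lac_term u L (k + j) s) = lac_sum u L s"
    unfolding lac_sum_def
    by (rule infsum_reindex_bij_betw) (rule bij_betwI[of _ _ _ "\<lambda>k. k - j"]; auto)
  finally show ?thesis .
qed

lemma norm_integral_cis_le:
  fixes c a b :: real
  assumes "c \<noteq> 0" "a \<le> b"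
  shows "norm (integral {a..b} (\<lambda>t. exp (\<i> * of_real (c * t)))) \<le> 2 / \<bar>c\<bar>"
proof -
  let ?F = "\<lambda>t. exp (\<i> * of_real (c * t)) / (\<i> * of_real c)"
  have "((\<lambda>t. exp (\<i> * of_real (c * t))) has_integral (?F b - ?F a)) {a..b}"
    using assms
    by (intro fundamental_theorem_of_calculus)
       (auto intro!: derivative_eq_intros has_vector_derivative_real_field simp: field_simps)
  then have "norm (integral {a..b} (\<lambda>t. exp (\<i> * of_real (c * t)))) = norm (?F b - ?F a)"
    by (simp add: integral_unique)
  also have "\<dots> \<le> norm (?F b) + norm (?F a)" by (rule norm_triangle_ineq4)
  also have "\<dots> = 2 / \<bar>c\<bar>" by (simp add: norm_divide norm_mult)
  finally show ?thesis .
qed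

text \<open>This is the lacunarity of the frequencies \<open>q\<^sup>k\<close>. Below \<open>1\<close> the nearest one is \<open>1 / q\<close>, and above \<open>1\<close> the
nearest one is \<open>q\<close>, which is even further away.\<close>

lemma frequency_gap:
  fixes L :: real
  assumes "L > 0" "k \<noteq> (0::int)"
  shows "\<bar>1 - exp (of_int k * L)\<bar> \<ge> 1 - exp (- L)"
proof (cases "k > 0")
  case True
  then have "real_of_int k \<ge> 1" by simp
  then have "of_int k * L \<ge> 1 * L" using assms by (intro mult_right_mono) auto
  then have "exp (of_int k * L) \<ge> exp L" by simp
  moreover have "exp L - 1 \<ge> 1 - exp (- L)"
    using exp_ge_add_one_self[of L] exp_ge_add_one_self[of "-L"] assms by linarith
  ultimately show ?thesis by linarith
next
  case False
  then have "of_int k \<le> (-1::real)" using assms by linarith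
  then have "of_int k * L \<le> -1 * L" using assms by (intro mult_right_mono) auto
  then have "exp (of_int k * L) \<le> exp (- L)" by simp
  then show ?thesis by linarith
qed

text \<open>The term \<open>k = 0\<close> is the one of frequency \<open>1\<close>; multiplied by \<open>exp (\<i> * t)\<close> it becomes the constant
\<open>exp (- 1)\<close>. Every other term oscillates with frequency at least \<open>1 - exp (- L)\<close>, so its integral is
bounded independently of the interval. The uniformity in \<open>a\<close> and \<open>b\<close> is essential, since the lemma is used for
intervals that move to infinity while they grow.\<close>

lemma mean_value_lac_sum:
  assumes "Re u > 0" "L > 0"
  obtains C where "\<And>a b. a \<le> b \<Longrightarrow>
     norm (integral {a..b} (\<lambda>t. lac_sum u L (1 + \<i> * of_real t) * exp (\<i> * of_real t)) - of_real ((b - a) * exp (-1))) \<le> C"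
proof
  define m where "m = lac_bound (Re u) L 1"
  have msum: "m summable_on UNIV" unfolding m_def by (rule summable_lac_bound) fact+
  define C where "C = (\<Sum>\<^sub>\<infinity>k\<in>UNIV - {0}. m k * (2 / (1 - exp (- L))))"
  fix a b :: real assume ab: "a \<le> b"
  define f where "f = (\<lambda>(k::int) (t::real). lac_term u L k (1 + \<i> * of_real t) * exp (\<i> * of_real t))"
  let ?I = "integral {a..b} (\<lambda>t. lac_sum u L (1 + \<i> * of_real t) * exp (\<i> * of_real t))"
  have f_eq: "f k = (\<lambda>t. lac_term u L k 1 * exp (\<i> * of_real ((1 - exp (of_int k * L)) * t)))" for k
    by (auto simp: f_def lac_term_def exp_add[symmetric] algebra_simps)
  have "((\<lambda>k. integral {a..b} (f k)) has_sum ?I) UNIV"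
  proof (rule integral_has_sum)
    show "continuous_on {a..b} (f k)" for k unfolding f_eq by (intro continuous_intros)
    show "norm (f k t) \<le> m k" for k t
      unfolding f_def m_def using norm_lac_term_le[of L 1 "1 + \<i> * of_real t" u k] assms
      by (simp add: norm_mult)
    show "m summable_on UNIV" by fact
    show "((\<lambda>k. f k t) has_sum lac_sum u L (1 + \<i> * of_real t) * exp (\<i> * of_real t)) UNIV" for t
      unfolding f_def by (intro has_sum_cmult_left lac_sum_has_sum) (use assms in auto)
  qed
  moreover have f0: "integral {a..b} (f 0) = of_real ((b - a) * exp (-1))"
    unfolding f_eq using ab by (simp add: lac_term_def scaleR_conv_of_real flip: exp_of_real)
  ultimately have "((\<lambda>k. integral {a..b} (f k)) has_sum (?I - of_real ((b - a) * exp (-1)))) (UNIV - {0})"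
    using has_sum_Diff[where f = "\<lambda>k. integral {a..b} (f k)" and b = ?I and B = UNIV and A = "{0}" and a = "integral {a..b} (f 0)"]
    by (simp add: has_sum_finite_iff)
  moreover have "((\<lambda>k. m k * (2 / (1 - exp (- L)))) has_sum C) (UNIV - {0})"
    unfolding C_def by (intro has_sum_infsum summable_on_cmult_left summable_on_subset[OF msum]) auto
  ultimately show "norm (?I - of_real ((b - a) * exp (-1))) \<le> C"
  proof (rule norm_infsum_le)
    fix k :: int assume k: "k \<in> UNIV - {0}"
    define c where "c = 1 - exp (of_int k * L)"
    have gap: "\<bar>c\<bar> \<ge> 1 - exp (- L)" "1 - exp (- L) > 0"
      using frequency_gap[of L k] k assms by (auto simp: c_def)
    have mk: "norm (lac_term u L k 1) \<le> m k"
      unfolding m_def using assms by (intro norm_lac_term_le) auto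
    have m0: "0 \<le> m k" using mk norm_ge_zero order_trans by blast
    have "norm (integral {a..b} (f k)) = norm (lac_term u L k 1) * norm (integral {a..b} (\<lambda>t. exp (\<i> * of_real (c * t))))"
      unfolding f_eq c_def[symmetric] integral_mult_right norm_mult ..
    also have "\<dots> \<le> m k * (2 / \<bar>c\<bar>)"
    proof (rule mult_mono[OF mk norm_integral_cis_le[OF _ ab] m0 norm_ge_zero])
      show "c \<noteq> 0" using gap by auto
    qed
    also have "\<dots> \<le> m k * (2 / (1 - exp (- L)))"
      using gap m0 by (intro mult_left_mono divide_left_mono mult_pos_pos) auto
    finally show "norm (integral {a..b} (f k)) \<le> m k * (2 / (1 - exp (- L)))" .
  qed
qed

text \<open>Every point of the imaginary axis is singular in the strong sense of unboundedness. Near \<open>\<i> * y0\<close> the sum at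
\<open>(1 + \<i> * t) / q\<^sup>N\<close> is \<open>q\<^sup>N\<^sup>u\<close> times the sum at \<open>1 + \<i> * t\<close>; a bound near \<open>\<i> * y0\<close> would thus force
the sum to be small on a long stretch of the line \<open>Re s = 1\<close>, against its mean value there.\<close>

theorem lac_sum_unbounded_at_imaginary:
  assumes "Re u > 0" "L > 0" "\<delta> > 0"
  shows "\<not> bounded (lac_sum u L ` {s. Re s > 0 \<and> dist s (\<i> * of_real y0) < \<delta>})"
proof
  assume "bounded (lac_sum u L ` {s. Re s > 0 \<and> dist s (\<i> * of_real y0) < \<delta>})"
  then obtain B where B: "\<And>s. Re s > 0 \<Longrightarrow> dist s (\<i> * of_real y0) < \<delta> \<Longrightarrow> norm (lac_sum u L s) \<le> B"
    unfolding bounded_iff by blast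
  obtain C where C: "\<And>a b. a \<le> b \<Longrightarrow>
     norm (integral {a..b} (\<lambda>t. lac_sum u L (1 + \<i> * of_real t) * exp (\<i> * of_real t)) - of_real ((b - a) * exp (-1))) \<le> C"
    using mean_value_lac_sum[OF assms(1,2)] by blast
  define x where "x = exp (- L)"
  define y where "y = exp (- (Re u * L))"
  have xy: "0 < x" "x < 1" "0 < y" "y < 1" using assms by (auto simp: x_def y_def)
  have key: "exp (-1) \<le> C / \<delta> * x ^ N + B * y ^ N" if N: "x ^ N < \<delta> / 2" for N
  proof -
    \<comment> \<open>scaling by \<open>Q\<close> maps a segment of length \<open>\<delta>\<close> on the line \<open>Re s = 1 / Q\<close>, close to \<open>\<i> * y0\<close>, onto the points \<open>1 + \<i> * t\<close> with \<open>t\<close> between \<open>a\<close> and \<open>b\<close>\<close>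
    define Q where "Q = exp (of_int (int N) * L)"
    have Q: "Q > 0" "x ^ N = 1 / Q"
      by (auto simp: Q_def x_def exp_of_nat_mult[symmetric] exp_minus field_simps)
    define a b where "a = Q * (y0 - \<delta> / 2)" and "b = Q * (y0 + \<delta> / 2)"
    have ba: "b - a = \<delta> * Q" by (simp add: a_def b_def algebra_simps)
    then have ab: "a < b" using assms Q mult_pos_pos[of \<delta> Q] by linarith
    have bound: "norm (lac_sum u L (1 + \<i> * of_real t)) \<le> B * y ^ N" if t: "t \<in> {a..b}" for t
    proof -
      define s where "s = (1 + \<i> * of_real t) / of_real Q"
      have "t / Q \<ge> y0 - \<delta> / 2" "t / Q \<le> y0 + \<delta> / 2"
        using t Q by (auto simp: a_def b_def field_simps)
      then have close: "\<bar>t / Q - y0\<bar> \<le> \<delta> / 2" by linarith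
      have "s - \<i> * of_real y0 = of_real (1 / Q) + \<i> * of_real (t / Q - y0)"
        using Q by (simp add: s_def field_simps)
      then have "dist s (\<i> * of_real y0) \<le> \<bar>1 / Q\<bar> + \<bar>t / Q - y0\<bar>"
        unfolding dist_norm
        by (metis norm_triangle_ineq norm_mult norm_ii mult_1 norm_of_real)
      also have "\<dots> < \<delta>" using close N Q by auto
      finally have "norm (lac_sum u L s) \<le> B" using Q by (intro B) (auto simp: s_def)
      moreover have "1 + \<i> * of_real t = exp (of_real (of_int (int N) * L)) * s"
        using Q(1) by (simp add: s_def exp_of_real Q_def[symmetric] del: of_int_of_nat_eq of_real_mult)
      then have "lac_sum u L (1 + \<i> * of_real t) = exp (- u * of_real (of_int (int N) * L)) * lac_sum u L s"
        by (simp only: lac_sum_scale)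
      moreover have "norm (exp (- u * of_real (of_int (int N) * L))) = y ^ N"
        by (simp add: y_def exp_of_nat_mult[symmetric])
      ultimately show ?thesis using xy by (simp add: norm_mult mult.commute)
    qed
    have "norm (integral {a..b} (\<lambda>t. lac_sum u L (1 + \<i> * of_real t) * exp (\<i> * of_real t))) \<le> B * y ^ N * (b - a)"
    proof (rule integral_bound)
      have "continuous_on {a..b} (\<lambda>t. lac_sum u L (1 + \<i> * of_real t))"
        by (rule continuous_on_compose2[OF holomorphic_on_imp_continuous_on[OF lac_sum_holomorphic[OF assms(1,2)]]])
           (auto intro!: continuous_intros)
      then show "continuous_on {a..b} (\<lambda>t. lac_sum u L (1 + \<i> * of_real t) * exp (\<i> * of_real t))"
        by (intro continuous_intros)
    qed (use ab bound in \<open>auto simp: norm_mult\<close>)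
    moreover have "norm (of_real ((b - a) * exp (-1)) :: complex) = (b - a) * exp (-1)"
      unfolding norm_of_real using ab by simp
    ultimately have "(b - a) * exp (-1) \<le> C + B * y ^ N * (b - a)"
      using C[of a b] ab norm_triangle_sub[of "of_real ((b - a) * exp (-1)) :: complex"
        "integral {a..b} (\<lambda>t. lac_sum u L (1 + \<i> * of_real t) * exp (\<i> * of_real t))"]
      by (simp add: norm_minus_commute)
    then show ?thesis unfolding ba Q(2) using Q assms by (simp add: field_simps)
  qed
  have "(\<lambda>N. C / \<delta> * x ^ N + B * y ^ N) \<longlonglongrightarrow> C / \<delta> * 0 + B * 0"
    using xy by (intro tendsto_intros LIMSEQ_power_zero) auto
  moreover have "\<forall>\<^sub>F N in sequentially. x ^ N < \<delta> / 2"
    using LIMSEQ_power_zero[of x] xy assms by (intro order_tendstoD(2)[of _ 0]) auto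
  then have "\<forall>\<^sub>F N in sequentially. exp (-1) \<le> C / \<delta> * x ^ N + B * y ^ N"
    by eventually_elim (rule key)
  ultimately have "exp (-1) \<le> C / \<delta> * 0 + B * (0::real)"
    using tendsto_lowerbound by (metis trivial_limit_sequentially)
  then show False by simp
qed

section \<open>The Gamma integral cut into logarithmic pieces\<close>

definition Gamma_integrand :: "complex \<Rightarrow> real \<Rightarrow> complex" where
  "Gamma_integrand w t = of_real t powr (w - 1) / of_real (exp t)"

lemma continuous_on_Gamma_integrand: "S \<subseteq> {0<..} \<Longrightarrow> continuous_on S (Gamma_integrand w)"
  unfolding Gamma_integrand_def
  by (intro continuous_intros) (auto simp: complex_nonpos_Reals_iff)

text \<open>This is the substitution \<open>\<tau> = exp ((x - t) * L)\<close> in Euler's integral. It turns a unit step of \<open>x\<close> into one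
logarithmic piece of the positive half-line, so that the integer translates tile the whole half-line.\<close>

lemma integral_Gamma_integrand_log:
  assumes "L > 0"
  shows "of_real L * integral {0..1} (\<lambda>t. exp (w * of_real ((x - t) * L) - of_real (exp ((x - t) * L)))) =
         integral {exp ((x - 1) * L)..exp (x * L)} (Gamma_integrand w)"
proof -
  define g where "g = (\<lambda>t. exp ((x - t) * L))"
  have pos: "g t > 0" for t by (simp add: g_def)
  have le: "g 1 < g 0" using assms by (simp add: g_def)
  have "((\<lambda>t. (- L * g t) *\<^sub>R Gamma_integrand w (g t)) has_integral
          (integral {g 0..g 1} (Gamma_integrand w) - integral {g 1..g 0} (Gamma_integrand w))) {0..1}"
  proof (rule has_integral_substitution_general[where s = "{}"])
    show "g ` {0..1} \<subseteq> {g 1..g 0}" using assms by (auto simp: g_def)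
    show "continuous_on {g 1..g 0} (Gamma_integrand w)"
      using pos[of 1] by (intro continuous_on_Gamma_integrand) auto
    show "continuous_on {0..1} g" unfolding g_def by (intro continuous_intros)
    show "(g has_field_derivative - L * g t) (at t within {0..1})" for t
      unfolding g_def by (auto intro!: derivative_eq_intros)
  qed auto
  moreover have "integral {g 0..g 1} (Gamma_integrand w) = 0" using le by simp
  moreover have "(- L * g t) *\<^sub>R Gamma_integrand w (g t) =
      - of_real L * exp (w * of_real ((x - t) * L) - of_real (exp ((x - t) * L)))" for t
  proof -
    have g: "of_real (g t) = exp (of_real ((x - t) * L) :: complex)" by (simp only: g_def exp_of_real)
    have "Ln (of_real (g t)) = of_real ((x - t) * L)"
      using pos[of t] by (simp add: Ln_of_real) (simp add: g_def)
    then have powr: "of_real (g t) powr (w - 1) = exp ((w - 1) * of_real ((x - t) * L))"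
      using pos[of t] by (simp add: powr_def)
    have "(- L * g t) *\<^sub>R Gamma_integrand w (g t) = - of_real L * (of_real (g t) *
         (exp ((w - 1) * of_real ((x - t) * L)) / exp (of_real (g t))))"
      unfolding Gamma_integrand_def powr by (simp add: scaleR_conv_of_real exp_of_real)
    also have "of_real (g t) * (exp ((w - 1) * of_real ((x - t) * L)) / exp (of_real (g t))) =
        exp (of_real ((x - t) * L)) * (exp ((w - 1) * of_real ((x - t) * L)) / exp (of_real (g t)))"
      by (simp only: g)
    also have "\<dots> = exp (w * of_real ((x - t) * L) - of_real (g t))"
      unfolding exp_diff[symmetric] mult_exp_exp by (simp add: algebra_simps)
    finally show ?thesis by (simp add: g_def)
  qed
  ultimately have "((\<lambda>t. - of_real L * exp (w * of_real ((x - t) * L) - of_real (exp ((x - t) * L))))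
      has_integral (- integral {g 1..g 0} (Gamma_integrand w))) {0..1}" by simp
  from integral_unique[OF this] show ?thesis by (simp add: g_def)
qed

lemma integral_Gamma_integrand_exhaust:
  assumes "Re w > 0" "L > 0"
  shows "(\<lambda>N. integral {exp (- real N * L)..exp (real N * L)} (Gamma_integrand w)) \<longlonglongrightarrow> Gamma w"
proof -
  define A where "A = (\<lambda>N. {exp (- real N * L)..exp (real N * L)})"
  have inc: "incseq A"
    unfolding A_def incseq_def using assms by (auto intro: order_trans simp: mult_right_mono)
  have Un: "(\<Union>N. A N) = {0<..}"
  proof (intro equalityI subsetI)
    fix t :: real assume "t \<in> {0<..}"
    then have t: "t > 0" by simp
    obtain N where N: "\<bar>ln t\<bar> / L \<le> real N" using real_arch_simple by blast
    then have "\<bar>ln t\<bar> \<le> real N * L" using assms by (simp add: field_simps)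
    then have "- real N * L \<le> ln t" "ln t \<le> real N * L" by linarith+
    then have "exp (- real N * L) \<le> exp (ln t)" "exp (ln t) \<le> exp (real N * L)" by simp_all
    then show "t \<in> (\<Union>N. A N)" using t by (auto simp: A_def)
  qed (auto simp: A_def intro: less_le_trans[OF exp_gt_zero])
  have int: "set_integrable lebesgue {0<..} (Gamma_integrand w)"
    unfolding Gamma_integrand_def using absolutely_integrable_Gamma_integral'[OF assms(1)] .
  have "(\<lambda>N. LINT t:A N|lebesgue. Gamma_integrand w t) \<longlonglongrightarrow> (LINT t:(\<Union>N. A N)|lebesgue. Gamma_integrand w t)"
    by (rule set_integral_cont_up) (use inc int Un in \<open>auto simp: A_def\<close>)
  moreover have "(LINT t:A N|lebesgue. Gamma_integrand w t) = integral (A N) (Gamma_integrand w)" for N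
    by (rule set_lebesgue_integral_eq_integral(2), rule set_integrable_subset[OF int])
       (use Un in \<open>auto simp: A_def\<close>)
  moreover have "(LINT t:(\<Union>N. A N)|lebesgue. Gamma_integrand w t) = Gamma w"
    unfolding Un set_lebesgue_integral_eq_integral(2)[OF int]
    using integral_unique[OF Gamma_integral_complex'[OF assms(1)]] by (simp add: Gamma_integrand_def[abs_def])
  ultimately show ?thesis by (simp add: A_def)
qed

text \<open>The range starts at \<open>1 - N\<close> rather than \<open>- N\<close> for the sake of the logarithmic pieces: the piece with index \<open>k\<close>
is the interval from \<open>q\<^sup>k\<^sup>-\<^sup>1\<close> to \<open>q\<^sup>k\<close>, so these indices tile exactly the interval from \<open>q\<^sup>-\<^sup>N\<close> to \<open>q\<^sup>N\<close>.\<close>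

lemma has_sum_int_symmetric_limit:
  fixes p :: "int \<Rightarrow> 'a :: {topological_comm_monoid_add, t2_space}"
  assumes "(p has_sum c) UNIV"
  shows "(\<lambda>N. sum p {1 - int N..int N}) \<longlonglongrightarrow> c"
proof -
  have "filterlim (\<lambda>N. {1 - int N..int N}) (finite_subsets_at_top UNIV) sequentially"
    unfolding filterlim_iff
  proof (intro allI impI)
    fix P :: "int set \<Rightarrow> bool" assume "eventually P (finite_subsets_at_top UNIV)"
    then obtain X where X: "finite X" "\<And>Y. finite Y \<Longrightarrow> X \<subseteq> Y \<Longrightarrow> P Y"
      unfolding eventually_finite_subsets_at_top by auto
    obtain M where M: "\<And>x. x \<in> X \<Longrightarrow> \<bar>x\<bar> \<le> M"
      using X(1) by (metis Max_ge finite_imageI imageI)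
    show "\<forall>\<^sub>F N in sequentially. P {1 - int N..int N}"
      using eventually_gt_at_top[of "nat M"]
    proof eventually_elim
      case (elim N)
      show ?case by (rule X(2)) (use elim M in \<open>fastforce+\<close>)
    qed
  qed
  then show ?thesis
    using assms unfolding has_sum_def by (rule filterlim_compose[rotated])
qed

text \<open>Once the sum over all pieces is known to converge, its value can be read off along any exhausting sequence of
index sets; the sequence chosen makes the pieces telescope into a truncated Euler integral.\<close>

lemma Gamma_has_sum_pieces:
  assumes "Re w > 0" "L > 0"
    and sum: "((\<lambda>k. integral {0..1} (\<lambda>t. exp (w * of_real ((of_int k - t) * L) - of_real (exp ((of_int k - t) * L)))))
               has_sum c) (UNIV :: int set)"
  shows "of_real L * c = Gamma w"
proof -
  define p where "p = (\<lambda>k::int. integral {exp ((of_int k - 1) * L)..exp (of_int k * L)} (Gamma_integrand w))"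
  have "(p has_sum of_real L * c) UNIV"
    using has_sum_cmult_right[OF sum, of "of_real L"]
    unfolding integral_Gamma_integrand_log[OF assms(2)] p_def .
  then have lim: "(\<lambda>N. sum p {1 - int N..int N}) \<longlonglongrightarrow> of_real L * c"
    by (rule has_sum_int_symmetric_limit)
  have "sum p {1 - int N..int N} = integral {exp (- real N * L)..exp (real N * L)} (Gamma_integrand w)" for N
  proof (induction N)
    case (Suc N)
    have "{1 - int (Suc N)..int (Suc N)} = insert (- int N) (insert (int N + 1) {1 - int N..int N})"
      by auto
    then have "sum p {1 - int (Suc N)..int (Suc N)} = p (- int N) + (p (int N + 1) + sum p {1 - int N..int N})"
      by simp
    also have "\<dots> = p (- int N) + sum p {1 - int N..int N} + p (int N + 1)" by simp
    also have "\<dots> = integral {exp (- real (Suc N) * L)..exp (- real N * L)} (Gamma_integrand w) +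
       integral {exp (- real N * L)..exp (real N * L)} (Gamma_integrand w) +
       integral {exp (real N * L)..exp (real (Suc N) * L)} (Gamma_integrand w)"
    proof -
      have "(of_int (- int N) - 1) * L = - real (Suc N) * L" "of_int (- int N) * L = - real N * L"
        "(of_int (int N + 1) - 1) * L = real N * L" "of_int (int N + 1) * L = real (Suc N) * L"
        by (simp_all add: algebra_simps)
      then show ?thesis unfolding Suc unfolding p_def by (simp only:)
    qed
    also have "\<dots> = integral {exp (- real (Suc N) * L)..exp (real (Suc N) * L)} (Gamma_integrand w)"
    proof -
      have int: "Gamma_integrand w integrable_on {exp a..b}" for a b
        by (intro integrable_continuous_real continuous_on_Gamma_integrand)
           (auto intro: less_le_trans[OF exp_gt_zero])
      have le: "- real (Suc N) * L \<le> - real N * L" "- real N * L \<le> real N * L" "real N * L \<le> real (Suc N) * L"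
        using assms by (auto simp: mult_right_mono algebra_simps)
      have "- real (Suc N) * L \<le> real N * L" using le by linarith
      then show ?thesis
        using le by (simp only: Henstock_Kurzweil_Integration.integral_combine[OF _ _ int] exp_le_cancel_iff)
    qed
    finally show ?case .
  qed simp
  with lim integral_Gamma_integrand_exhaust[OF assms(1,2)] show ?thesis
    by (simp add: LIMSEQ_unique)
qed

section \<open>The periodic sum as a function on the annulus\<close>

text \<open>This is the sum of \<open>exp (u * x - exp x)\<close> over all translates \<open>x = y + k * L\<close>.\<close>

definition periodized :: "complex \<Rightarrow> real \<Rightarrow> complex \<Rightarrow> complex" where
  "periodized u L y = exp (u * y) * lac_sum u L (exp y)"

lemma periodized_periodic: "periodized u L (y + of_real (of_int j * L)) = periodized u L y"
proof -
  have "lac_sum u L (exp (y + of_real (of_int j * L))) = exp (- u * of_real (of_int j * L)) * lac_sum u L (exp y)"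
    unfolding exp_add mult.commute[of "exp y"] by (rule lac_sum_scale)
  then have "periodized u L (y + of_real (of_int j * L)) =
      (exp (u * (y + of_real (of_int j * L))) * exp (- u * of_real (of_int j * L))) * lac_sum u L (exp y)"
    by (simp add: periodized_def)
  also have "exp (u * (y + of_real (of_int j * L))) * exp (- u * of_real (of_int j * L)) = exp (u * y)"
    unfolding mult_exp_exp by (simp add: algebra_simps)
  finally show ?thesis by (simp add: periodized_def)
qed

lemma Re_exp_pos: "\<bar>Im y\<bar> < pi / 2 \<Longrightarrow> Re (exp y) > 0"
  unfolding Re_exp by (intro mult_pos_pos cos_gt_zero_pi) auto

lemma periodized_holomorphic:
  assumes "Re u > 0" "L > 0"
  shows "periodized u L holomorphic_on {y. \<bar>Im y\<bar> < pi / 2}"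
proof -
  have "(lac_sum u L \<circ> exp) holomorphic_on {y. \<bar>Im y\<bar> < pi / 2}"
    by (rule holomorphic_on_compose_gen[OF _ lac_sum_holomorphic[OF assms]])
       (auto intro!: holomorphic_intros Re_exp_pos)
  then show ?thesis
    unfolding periodized_def[abs_def] o_def by (intro holomorphic_intros)
qed

text \<open>The scale is chosen so that a turn \<open>2 * pi * \<i>\<close> of the logarithm becomes, up to sign, the real period \<open>L\<close> and the
half-width \<open>pi\<^sup>2 / L\<close> of the annulus in \<open>Re \<zeta>\<close> becomes the half-width \<open>pi / 2\<close> of the strip.\<close>

definition log_scale :: "real \<Rightarrow> complex \<Rightarrow> complex" where
  "log_scale L \<zeta> = \<i> * of_real (L / (2 * pi)) * \<zeta>"

definition annulus_fun :: "complex \<Rightarrow> real \<Rightarrow> complex \<Rightarrow> complex" where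
  "annulus_fun u L z = periodized u L (log_scale L (Ln z))"

abbreviation annulus :: "real \<Rightarrow> complex set" where
  "annulus v \<equiv> {z. exp (- v) < norm z \<and> norm z < exp v}"

text \<open>Any logarithm of \<open>z\<close> may replace the principal one: two of them differ by a multiple of \<open>2 * pi * \<i>\<close>, hence
after scaling by a period.\<close>

lemma annulus_fun_exp: "annulus_fun u L (exp \<zeta>) = periodized u L (log_scale L \<zeta>)"
proof -
  have "exp (Ln (exp \<zeta>)) = exp \<zeta>" by simp
  then obtain n :: int where n: "Ln (exp \<zeta>) = \<zeta> + (of_int (2 * n) * pi) * \<i>"
    unfolding exp_eq by blast
  have "log_scale L (Ln (exp \<zeta>)) = log_scale L \<zeta> + of_real (of_int (- n) * L)"
    unfolding n log_scale_def by (simp add: field_simps)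
  then show ?thesis
    unfolding annulus_fun_def by (simp only: periodized_periodic)
qed

lemma Im_log_scale: "Im (log_scale L \<zeta>) = L / (2 * pi) * Re \<zeta>"
  by (simp add: log_scale_def)

lemma Im_log_scale_less:
  assumes "L > 0" "exp \<zeta> \<in> annulus (pi\<^sup>2 / L)"
  shows "\<bar>Im (log_scale L \<zeta>)\<bar> < pi / 2"
proof -
  have "- (pi\<^sup>2 / L) < Re \<zeta>" "Re \<zeta> < pi\<^sup>2 / L" using assms by auto
  then have "\<bar>Re \<zeta>\<bar> < pi\<^sup>2 / L" by linarith
  then have "L / (2 * pi) * \<bar>Re \<zeta>\<bar> < L / (2 * pi) * (pi\<^sup>2 / L)"
    using assms by (intro mult_strict_left_mono) auto
  also have "\<dots> = pi / 2" using assms by (simp add: power2_eq_square)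
  finally show ?thesis using assms by (simp add: Im_log_scale abs_mult)
qed

text \<open>The principal logarithm handles the plane slit along the negative axis; the branch \<open>Ln (- z) + \<i> * pi\<close> gives the
same function on the plane slit along the positive axis. The two slit annuli cover the annulus.\<close>

lemma annulus_fun_holomorphic:
  assumes "Re u > 0" "L > 0"
  shows "annulus_fun u L holomorphic_on annulus (pi\<^sup>2 / L)"
proof -
  let ?A = "annulus (pi\<^sup>2 / L)"
  have nz: "z \<noteq> 0" if "z \<in> ?A" for z using that by auto
  have comp: "(\<lambda>z. periodized u L (log_scale L (l z))) holomorphic_on S"
    if "l holomorphic_on S" "\<And>z. z \<in> S \<Longrightarrow> exp (l z) \<in> ?A" for l S
  proof -
    have "(periodized u L \<circ> (\<lambda>z. log_scale L (l z))) holomorphic_on S"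
      by (rule holomorphic_on_compose_gen[OF _ periodized_holomorphic[OF assms]])
         (use that assms Im_log_scale_less in \<open>auto simp: log_scale_def[abs_def] intro!: holomorphic_intros\<close>)
    then show ?thesis by (simp add: o_def)
  qed
  have 1: "annulus_fun u L holomorphic_on (?A - \<real>\<^sub>\<le>\<^sub>0)"
    unfolding annulus_fun_def[abs_def]
    by (rule comp) (use nz in \<open>auto intro!: holomorphic_intros\<close>)
  have "(\<lambda>z. periodized u L (log_scale L (Ln (- z) + \<i> * of_real pi))) holomorphic_on (?A - \<real>\<^sub>\<ge>\<^sub>0)"
    by (rule comp)
       (use nz in \<open>auto intro!: holomorphic_intros simp: exp_add complex_nonpos_Reals_iff complex_nonneg_Reals_iff\<close>)
  moreover have "periodized u L (log_scale L (Ln (- z) + \<i> * of_real pi)) = annulus_fun u L z" if "z \<in> ?A - \<real>\<^sub>\<ge>\<^sub>0" for z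
  proof -
    have "exp (Ln (- z) + \<i> * of_real pi) = z" using nz[of z] that by (simp add: exp_add)
    then show ?thesis using annulus_fun_exp[of u L "Ln (- z) + \<i> * of_real pi"] by simp
  qed
  ultimately have 2: "annulus_fun u L holomorphic_on (?A - \<real>\<^sub>\<ge>\<^sub>0)"
    by (rule holomorphic_transform)
  have "annulus_fun u L holomorphic_on (?A - \<real>\<^sub>\<le>\<^sub>0) \<union> (?A - \<real>\<^sub>\<ge>\<^sub>0)"
    by (rule holomorphic_on_Un[OF 1 2]) (auto intro!: open_Diff open_annulus)
  moreover have "(?A - \<real>\<^sub>\<le>\<^sub>0) \<union> (?A - \<real>\<^sub>\<ge>\<^sub>0) = ?A"
    using nz by (auto simp: complex_nonpos_Reals_iff complex_nonneg_Reals_iff complex_eq_iff)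
  ultimately show ?thesis by simp
qed

text \<open>Unfolding the period: on the unit circle the function is the sum over \<open>k\<close> of the values of
\<open>exp (u * x - exp x)\<close> at \<open>x = (k - t) * L\<close>, and \<open>exp (- 2 * pi * \<i> * n * t)\<close> equals
\<open>exp (2 * pi * \<i> * n * x / L)\<close> as \<open>k\<close> is an integer. This moves \<open>u\<close> to \<open>w = u + 2 * pi * \<i> * n / L\<close> and the pieces
add up to the Euler integral at \<open>w\<close>.\<close>

lemma annulus_fun_coeff:
  fixes n :: int
  assumes "Re u > 0" "L > 0"
  shows "of_real L * circle_mean 1 (\<lambda>w. annulus_fun u L w * w powi (- n)) =
         Gamma (u + 2 * of_real pi * \<i> * of_int n / of_real L)"
proof -
  define w where "w = u + 2 * of_real pi * \<i> * of_int n / of_real L"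
  define f where "f = (\<lambda>(k::int) (t::real). exp (w * of_real ((of_int k - t) * L) - of_real (exp ((of_int k - t) * L))))"
  define e where "e = (\<lambda>t::real. exp (- 2 * of_real pi * \<i> * of_int n * of_real t))"
  have f_eq: "f k t = exp (u * of_real (- t * L)) * lac_term u L k (exp (of_real (- t * L))) * e t" for k t
  proof -
    have per: "exp (2 * of_real pi * \<i> * of_int n * of_int k) = (1 :: complex)"
      using exp_integer_2pi[of "of_int (n * k)"] by (simp add: mult_ac)
    have ex: "of_real (exp ((of_int k - t) * L)) = of_real (exp (of_int k * L)) * exp (of_real (- t * L) :: complex)"
      by (simp add: algebra_simps exp_diff exp_of_real[symmetric] exp_minus divide_inverse)
    have "w * of_real ((of_int k - t) * L) = u * of_real (- t * L) + u * of_real (of_int k * L)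
        + - 2 * of_real pi * \<i> * of_int n * of_real t + 2 * of_real pi * \<i> * of_int n * of_int k"
      using assms by (simp add: w_def field_simps)
    then show ?thesis
      unfolding f_def lac_term_def e_def ex mult_exp_exp
      by (simp add: exp_diff exp_add per del: of_real_mult of_real_minus)
  qed
  have mean: "circle_mean 1 (\<lambda>w. annulus_fun u L w * w powi (- n)) =
      integral {0..1} (\<lambda>t. exp (u * of_real (- t * L)) * lac_sum u L (exp (of_real (- t * L))) * e t)"
    unfolding circle_mean_def
  proof (rule integral_cong)
    fix t :: real
    define \<zeta> where "\<zeta> = 2 * of_real pi * \<i> * of_real t"
    have c: "circle_point 1 t = exp \<zeta>" by (simp add: circle_point_def \<zeta>_def)
    have "log_scale L \<zeta> = of_real (- t * L)" by (simp add: log_scale_def \<zeta>_def complex_eq_iff)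
    moreover have "exp \<zeta> powi (- n) = e t" unfolding exp_power_int e_def \<zeta>_def by (simp add: mult_ac)
    ultimately show "annulus_fun u L (circle_point 1 t) * circle_point 1 t powi (- n) =
        exp (u * of_real (- t * L)) * lac_sum u L (exp (of_real (- t * L))) * e t"
      unfolding c annulus_fun_exp by (simp only: periodized_def)
  qed
  have "((\<lambda>k. integral {0..1} (f k)) has_sum circle_mean 1 (\<lambda>w. annulus_fun u L w * w powi (- n))) UNIV"
    unfolding mean
  proof (rule integral_has_sum)
    show "continuous_on {0..1} (f k)" for k unfolding f_def by (intro continuous_intros)
    show "norm (f k t) \<le> lac_bound (Re u) L (exp (- L)) k" if t: "t \<in> {0..1}" for k t
    proof -
      have "norm (lac_term u L k (exp (of_real (- t * L)))) \<le> lac_bound (Re u) L (exp (- L)) k"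
        by (rule norm_lac_term_le) (use assms t in \<open>auto simp: Re_exp mult_left_le_one_le\<close>)
      moreover have "norm (exp (u * of_real (- t * L))) \<le> 1"
        using assms t by simp
      moreover have "norm (e t) = 1" by (simp add: e_def)
      ultimately show ?thesis
        unfolding f_eq norm_mult by (metis mult_left_le_one_le mult.right_neutral norm_ge_zero order_trans)
    qed
    show "lac_bound (Re u) L (exp (- L)) summable_on UNIV" by (rule summable_lac_bound) fact+
    show "((\<lambda>k. f k t) has_sum exp (u * of_real (- t * L)) * lac_sum u L (exp (of_real (- t * L))) * e t) UNIV" for t
      unfolding f_eq using assms
      by (intro has_sum_cmult_left has_sum_cmult_right lac_sum_has_sum) (auto simp: Re_exp)
  qed
  moreover have "Re w > 0" using assms by (simp add: w_def)
  ultimately show ?thesis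
    unfolding f_def w_def[symmetric] using assms by (intro Gamma_has_sum_pieces)
qed

lemma Gamma_Laurent_series:
  assumes "Re u > 0" "L > 0" "z \<in> annulus (pi\<^sup>2 / L)"
  shows "((\<lambda>n::int. Gamma (u + 2 * of_real pi * \<i> * of_int n / of_real L) * z powi n) has_sum
          of_real L * annulus_fun u L z) UNIV"
proof -
  have "pi\<^sup>2 / L > 0" using assms by simp
  then have "((\<lambda>n::int. circle_mean 1 (\<lambda>w. annulus_fun u L w * w powi (- n)) * z powi n) has_sum annulus_fun u L z) UNIV"
    by (intro Laurent_series_annulus[OF annulus_fun_holomorphic[OF assms(1,2)]]) (use assms in auto)
  from has_sum_cmult_right[OF this, of "of_real L"] show ?thesis
    unfolding mult.assoc[symmetric] annulus_fun_coeff[OF assms(1,2)] .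
qed

text \<open>Both boundary circles are treated at once. A point \<open>z0\<close> on either of them corresponds to a nonzero purely imaginary \<open>s0\<close>, in the
upper half-plane for the outer circle and in the lower one for the inner circle. Near \<open>s0\<close> the function differs from
the lacunary sum only by the continuous nonvanishing factor \<open>exp (u * Ln s)\<close>.\<close>

lemma annulus_fun_unbounded:
  assumes u: "Re u > 0" and L: "L > 0" and z0: "norm z0 = exp (- (pi\<^sup>2 / L)) \<or> norm z0 = exp (pi\<^sup>2 / L)"
    and r: "r > 0"
  shows "\<not> bounded (annulus_fun u L ` (ball z0 r \<inter> annulus (pi\<^sup>2 / L)))"
proof
  assume "bounded (annulus_fun u L ` (ball z0 r \<inter> annulus (pi\<^sup>2 / L)))"
  then obtain B where B: "\<And>z. z \<in> ball z0 r \<Longrightarrow> z \<in> annulus (pi\<^sup>2 / L) \<Longrightarrow> norm (annulus_fun u L z) \<le> B"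
    unfolding bounded_iff by blast
  \<comment> \<open>\<open>l\<close> is a logarithm of the point \<open>z\<close> that corresponds to \<open>s\<close>\<close>
  define l where "l = (\<lambda>s. Ln s * (2 * of_real pi / (\<i> * of_real L)))"
  have log_l: "log_scale L (l s) = Ln s" for s
    using L by (simp add: log_scale_def l_def field_simps)
  have z0_nz: "z0 \<noteq> 0" using z0 by auto
  define s0 where "s0 = exp (log_scale L (Ln z0))"
  have Im0: "\<bar>Im (log_scale L (Ln z0))\<bar> = pi / 2"
    using z0 z0_nz L by (auto simp: Im_log_scale abs_mult power2_eq_square)
  then have "Im (log_scale L (Ln z0)) = pi / 2 \<or> Im (log_scale L (Ln z0)) = - (pi / 2)" by linarith
  then have cos0: "cos (Im (log_scale L (Ln z0))) = 0" by (metis cos_pi_half cos_minus)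
  have Re0: "Re s0 = 0" unfolding s0_def Re_exp cos0 by simp
  have s0_eq: "s0 = \<i> * of_real (Im s0)" using Re0 by (simp add: complex_eq_iff)
  have s0_nz: "s0 \<noteq> 0" by (simp add: s0_def)
  then have s0_slit: "s0 \<notin> \<real>\<^sub>\<le>\<^sub>0" using Re0 by (auto simp: complex_nonpos_Reals_iff complex_eq_iff)
  have "Ln s0 = log_scale L (Ln z0)"
    unfolding s0_def by (rule Ln_exp) (use Im0 pi_gt_zero in linarith)+
  then have l0: "l s0 = Ln z0" using L by (simp add: l_def log_scale_def)
  have c1: "isCont (\<lambda>s. exp (l s)) s0" and c2: "isCont (\<lambda>s. exp (- u * Ln s)) s0"
    unfolding l_def using s0_slit L by (auto intro!: continuous_intros)
  obtain d1 where d1: "d1 > 0" "\<And>s. dist s s0 < d1 \<Longrightarrow> dist (exp (l s)) z0 < r"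
    using c1 r z0_nz unfolding continuous_at_eps_delta l0 by (auto simp: l0)
  obtain d2 where d2: "d2 > 0" "\<And>s. dist s s0 < d2 \<Longrightarrow> dist (exp (- u * Ln s)) (exp (- u * Ln s0)) < 1"
    using c2 unfolding continuous_at_eps_delta by (metis zero_less_one)
  define M where "M = 1 + norm (exp (- u * Ln s0))"
  have "norm (lac_sum u L s) \<le> M * B" if s: "Re s > 0" "dist s s0 < min d1 d2" for s
  proof -
    have s_nz: "s \<noteq> 0" using s by auto
    have Im_s: "\<bar>Im (Ln s)\<bar> < pi / 2" using s(1) Re_Ln_pos_lt[OF s_nz] by simp
    have "Re (l s) = Im (Ln s) * (2 * pi / L)"
      using L by (simp add: l_def Re_divide Im_divide power2_eq_square field_simps)
    then have "\<bar>Re (l s)\<bar> = \<bar>Im (Ln s)\<bar> * (2 * pi / L)"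
      using L by (simp add: abs_mult)
    moreover have "\<bar>Im (Ln s)\<bar> * (2 * pi / L) < (pi / 2) * (2 * pi / L)"
      by (rule mult_strict_right_mono[OF Im_s]) (use L in simp)
    ultimately have "\<bar>Re (l s)\<bar> < pi\<^sup>2 / L" by (simp add: power2_eq_square)
    then have "exp (l s) \<in> annulus (pi\<^sup>2 / L)" by auto
    moreover have "exp (l s) \<in> ball z0 r" using d1(2)[of s] s by (simp add: dist_commute)
    ultimately have le: "norm (annulus_fun u L (exp (l s))) \<le> B" by (intro B)
    have "annulus_fun u L (exp (l s)) = exp (u * Ln s) * lac_sum u L s"
      unfolding annulus_fun_exp log_l periodized_def using s_nz by simp
    then have sum_eq: "lac_sum u L s = exp (- u * Ln s) * annulus_fun u L (exp (l s))"
      by (simp add: exp_minus)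
    have M_le: "norm (exp (- u * Ln s)) \<le> M"
      using d2(2)[of s] s norm_triangle_sub[of "exp (- u * Ln s)" "exp (- u * Ln s0)"]
      by (simp add: M_def dist_norm)
    show ?thesis
      unfolding sum_eq norm_mult
      by (rule mult_mono[OF M_le le]) (auto simp: M_def)
  qed
  then have "bounded (lac_sum u L ` {s. Re s > 0 \<and> dist s (\<i> * of_real (Im s0)) < min d1 d2})"
    unfolding bounded_iff s0_eq[symmetric] by blast
  moreover have "min d1 d2 > 0" using d1 d2 by simp
  ultimately show False
    using lac_sum_unbounded_at_imaginary[OF u L] by blast
qed

lemma frontier_annulus:
  fixes v :: real
  assumes "v > 0"
  shows "frontier (annulus v) = {z. norm z = exp (- v)} \<union> {z. norm z = exp v}"
proof
  have "closed {z :: complex. exp (- v) \<le> norm z \<and> norm z \<le> exp v}"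
    by (intro closed_Collect_conj closed_Collect_le continuous_intros)
  then have "closure (annulus v) \<subseteq> {z. exp (- v) \<le> norm z \<and> norm z \<le> exp v}"
    by (intro closure_minimal) auto
  moreover have "frontier (annulus v) = closure (annulus v) - annulus v"
    by (simp add: frontier_def interior_open open_annulus)
  ultimately show "frontier (annulus v) \<subseteq> {z. norm z = exp (- v)} \<union> {z. norm z = exp v}"
    by fastforce
  show "{z. norm z = exp (- v)} \<union> {z. norm z = exp v} \<subseteq> frontier (annulus v)"
  proof
    fix z :: complex assume z: "z \<in> {z. norm z = exp (- v)} \<union> {z. norm z = exp v}"
    then have "z \<noteq> 0" by auto
    then have ez: "exp (Ln z) = z" and Re: "Re (Ln z) = v \<or> Re (Ln z) = - v"
      using z by auto
    \<comment> \<open>the points \<open>exp (c n * Ln z)\<close> approach \<open>z\<close> along a path on which \<open>\<bar>ln \<bar>z\<bar>\<bar>\<close> increases to \<open>v\<close>\<close>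
    define c where "c = (\<lambda>n. 1 - inverse (real (Suc n)))"
    have "(\<lambda>n. exp (of_real (c n) * Ln z)) \<longlonglongrightarrow> exp (of_real (1 - 0) * Ln z)"
      unfolding c_def by (intro tendsto_intros LIMSEQ_inverse_real_of_nat)
    then have lim: "(\<lambda>n. exp (of_real (c n) * Ln z)) \<longlonglongrightarrow> z" using ez by simp
    have "exp (of_real (c n) * Ln z) \<in> annulus v" for n
    proof -
      have c: "0 \<le> c n" "c n < 1" by (auto simp: c_def field_simps)
      then have "c n * v < 1 * v" "0 \<le> c n * v" using assms by (auto simp: mult_strict_right_mono)
      then show ?thesis using Re assms by auto
    qed
    then have "z \<in> closure (annulus v)"
      using lim unfolding closure_sequential
      by (intro exI[of _ "\<lambda>n. exp (of_real (c n) * Ln z)"] conjI allI)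
    then show "z \<in> frontier (annulus v)"
      using z by (auto simp: frontier_def interior_open open_annulus)
  qed
qed

theorem mainTheorem1:
  fixes u :: complex and v :: real
  assumes "Re u > 0" and "v > 0"
  shows "frontier {z :: complex. exp (- v) < norm z \<and> norm z < exp v}
           = {z. norm z = exp (- v)} \<union> {z. norm z = exp v}
         \<and> has_natural_boundary (Psi u v) {z. exp (- v) < norm z \<and> norm z < exp v}"
proof (intro conjI)
  show frontier: "frontier (annulus v) = {z. norm z = exp (- v)} \<union> {z. norm z = exp v}"
    by (rule frontier_annulus) fact
  define L where "L = pi\<^sup>2 / v"
  have L: "L > 0" "pi\<^sup>2 / L = v" using assms by (auto simp: L_def)
  have arg: "2 * \<i> * of_real v * of_int n / of_real pi = 2 * of_real pi * \<i> * of_int n / of_real L" for n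
    using assms by (simp add: L_def power2_eq_square field_simps)
  have Psi: "Psi u v z = of_real L * annulus_fun u L z" if "z \<in> annulus v" for z
    unfolding Psi_def arg
    by (rule infsumI, rule Gamma_Laurent_series) (use assms L that in auto)
  show "has_natural_boundary (Psi u v) (annulus v)"
    unfolding has_natural_boundary_def
  proof (intro conjI ballI notI)
    show "open (annulus v)" by (rule open_annulus)
    show "connected (annulus v)"
      using connected_annulus(1)[of "exp (- v)" "0 :: complex" "exp v"] by simp
    have "(\<lambda>z. of_real L * annulus_fun u L z) holomorphic_on annulus v"
      using annulus_fun_holomorphic[OF assms(1) L(1)] unfolding L(2) by (intro holomorphic_intros)
    then show "Psi u v holomorphic_on annulus v"
      by (rule holomorphic_transform) (simp add: Psi)
  next
    fix z0 assume "z0 \<in> frontier (annulus v)"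
    then have z0: "norm z0 = exp (- (pi\<^sup>2 / L)) \<or> norm z0 = exp (pi\<^sup>2 / L)"
      unfolding frontier L(2) by auto
    assume "\<exists>r>0. \<exists>g. g holomorphic_on ball z0 r \<and> (\<forall>z\<in>ball z0 r \<inter> annulus v. g z = Psi u v z)"
    then obtain r g where r: "r > 0" and g: "g holomorphic_on ball z0 r"
      and eq: "\<And>z. z \<in> ball z0 r \<inter> annulus v \<Longrightarrow> g z = Psi u v z" by blast
    \<comment> \<open>a continuation is bounded on a smaller closed disc, hence so is the function on the part inside the annulus\<close>
    have "bounded (g ` cball z0 (r / 2))"
      by (intro compact_imp_bounded compact_continuous_image compact_cball
            continuous_on_subset[OF holomorphic_on_imp_continuous_on[OF g]])
         (use r in auto)
    then obtain B where B: "\<And>z. z \<in> cball z0 (r / 2) \<Longrightarrow> norm (g z) \<le> B"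
      unfolding bounded_iff by blast
    have "norm (annulus_fun u L z) \<le> B / L" if "z \<in> ball z0 (r / 2) \<inter> annulus v" for z
    proof -
      have "norm (of_real L * annulus_fun u L z) \<le> B"
        using eq[of z] Psi[of z] B[of z] that r by auto
      then show ?thesis using L(1) by (simp add: norm_mult field_simps)
    qed
    then have "bounded (annulus_fun u L ` (ball z0 (r / 2) \<inter> annulus v))"
      unfolding bounded_iff by blast
    then show False
      using annulus_fun_unbounded[OF assms(1) L(1) z0, of "r / 2"] r unfolding L(2) by simp
  qed
qed

end
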